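(* Let $\mathbb{M}$ be a monster model of a complete $C$-minimal expansion of ACVF whose language contains a constant symbol $t$ with $v(t)>0$. Let $B\subseteq\mathbb{M}$ be a ball containing $0$, let $U\subseteq\mathbb{M}$ be definable and open, and let $f:U\times B\to\mathbb{M}$ be a definable function such that $\lim_{y\to0}f(a,y)=f(a,0)$ for every $a\in U$. Then $f$ is continuous at $(a,0)$ for all but finitely many $a\in U$.
   Context: ACVF is the theory of algebraically closed non-trivially valued fields; $C$-minimal means every definable subset of the home sort is a finite boolean combination of balls and points. "Definable" means with parameters; topology is the valuation topology (product topology on $\mathbb{M}^2$). *)

theory Defs
  imports "HOL-Analysis.Analysis" "HOL-Library.Extended"
begin

unbundle cardinal_syntax

section \<open>Valued fields\<close>

text \<open>
  Valuations are written additively: \<open>v x = \<infinity>\<close> exactly for \<open>x = 0\<close>, the value \<open>-\<infinity>\<close> of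
  \<^typ>\<open>'g extended\<close> is never taken, and \<open>'g\<close> is the whole value group.
\<close>

definition valuation :: "('a::field \<Rightarrow> 'g::linordered_ab_group_add extended) \<Rightarrow> bool" where
  "valuation v \<longleftrightarrow>
     (\<forall>x. v x = \<infinity> \<longleftrightarrow> x = 0) \<and>
     (\<forall>x. v x \<noteq> -\<infinity>) \<and>
     (\<forall>x y. v (x * y) = v x + v y) \<and>
     (\<forall>x y. min (v x) (v y) \<le> v (x + y)) \<and>
     (\<forall>\<gamma>. \<exists>x. v x = Fin \<gamma>)"

definition nontrivial_valuation :: "('a::field \<Rightarrow> 'g::linordered_ab_group_add extended) \<Rightarrow> bool" where
  "nontrivial_valuation v \<longleftrightarrow> valuation v \<and> (\<exists>x. x \<noteq> 0 \<and> v x \<noteq> 0)"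

definition open_vball :: "('a::field \<Rightarrow> 'g::linordered_ab_group_add extended) \<Rightarrow> 'a \<Rightarrow> 'g \<Rightarrow> 'a set" where
  "open_vball v c \<gamma> = {x. Fin \<gamma> < v (x - c)}"

definition closed_vball :: "('a::field \<Rightarrow> 'g::linordered_ab_group_add extended) \<Rightarrow> 'a \<Rightarrow> 'g \<Rightarrow> 'a set" where
  "closed_vball v c \<gamma> = {x. Fin \<gamma> \<le> v (x - c)}"

definition is_vball :: "('a::field \<Rightarrow> 'g::linordered_ab_group_add extended) \<Rightarrow> 'a set \<Rightarrow> bool" where
  "is_vball v B \<longleftrightarrow> (\<exists>c \<gamma>. B = open_vball v c \<gamma> \<or> B = closed_vball v c \<gamma>)"

definition valuation_topology :: "('a::field \<Rightarrow> 'g::linordered_ab_group_add extended) \<Rightarrow> 'a topology" where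
  "valuation_topology v = topology_generated_by {open_vball v c \<gamma> | c \<gamma>. True}"


section \<open>First-order expansions of valued fields\<close>

text \<open>
  The one-sorted language of valued fields, with its ring operations and the binary relation
  \<open>v x \<le> v y\<close>, is built into the syntax. An expansion of it is given by the arities of the
  additional symbols; those \<open>f\<close> and \<open>R\<close> that are mapped to \<^term>\<open>None\<close> do not belong to the
  language. Constant symbols are function symbols of arity \<open>0\<close>.
\<close>

record ('f, 'r) lang =
  fun_arity :: "'f \<Rightarrow> nat option"
  rel_arity :: "'r \<Rightarrow> nat option"

datatype 'f tm =
    Var nat
  | Zero
  | One
  | Plus "'f tm" "'f tm"
  | Minus "'f tm" "'f tm"
  | Times "'f tm" "'f tm"
  | Fn 'f "'f tm list"

datatype ('f, 'r) fm =
    Eq "'f tm" "'f tm"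
  | ValLe "'f tm" "'f tm"
  | Rel 'r "'f tm list"
  | Neg "('f, 'r) fm"
  | Conj "('f, 'r) fm" "('f, 'r) fm"
  | Ex nat "('f, 'r) fm"

primrec wf_tm :: "('f, 'r) lang \<Rightarrow> 'f tm \<Rightarrow> bool" where
  "wf_tm L (Var i) = True"
| "wf_tm L Zero = True"
| "wf_tm L One = True"
| "wf_tm L (Plus s t) = (wf_tm L s \<and> wf_tm L t)"
| "wf_tm L (Minus s t) = (wf_tm L s \<and> wf_tm L t)"
| "wf_tm L (Times s t) = (wf_tm L s \<and> wf_tm L t)"
| "wf_tm L (Fn f ts) = (fun_arity L f = Some (length ts) \<and> list_all id (map (wf_tm L) ts))"

primrec wf_fm :: "('f, 'r) lang \<Rightarrow> ('f, 'r) fm \<Rightarrow> bool" where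
  "wf_fm L (Eq s t) = (wf_tm L s \<and> wf_tm L t)"
| "wf_fm L (ValLe s t) = (wf_tm L s \<and> wf_tm L t)"
| "wf_fm L (Rel R ts) = (rel_arity L R = Some (length ts) \<and> list_all (wf_tm L) ts)"
| "wf_fm L (Neg \<phi>) = wf_fm L \<phi>"
| "wf_fm L (Conj \<phi> \<psi>) = (wf_fm L \<phi> \<and> wf_fm L \<psi>)"
| "wf_fm L (Ex i \<phi>) = wf_fm L \<phi>"

primrec fv_tm :: "'f tm \<Rightarrow> nat set" where
  "fv_tm (Var i) = {i}"
| "fv_tm Zero = {}"
| "fv_tm One = {}"
| "fv_tm (Plus s t) = fv_tm s \<union> fv_tm t"
| "fv_tm (Minus s t) = fv_tm s \<union> fv_tm t"
| "fv_tm (Times s t) = fv_tm s \<union> fv_tm t"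
| "fv_tm (Fn f ts) = \<Union> (set (map fv_tm ts))"

primrec fv :: "('f, 'r) fm \<Rightarrow> nat set" where
  "fv (Eq s t) = fv_tm s \<union> fv_tm t"
| "fv (ValLe s t) = fv_tm s \<union> fv_tm t"
| "fv (Rel R ts) = \<Union> (fv_tm ` set ts)"
| "fv (Neg \<phi>) = fv \<phi>"
| "fv (Conj \<phi> \<psi>) = fv \<phi> \<union> fv \<psi>"
| "fv (Ex i \<phi>) = fv \<phi> - {i}"

text \<open>
  The universe of a structure is the whole field \<open>'a\<close>, whose ring operations interpret the ring
  symbols. The interpretations of extra symbols matter only on argument lists of the right length.
\<close>

record ('a, 'g, 'f, 'r) vstruct =
  val :: "'a \<Rightarrow> 'g extended"
  fun_interp :: "'f \<Rightarrow> 'a list \<Rightarrow> 'a"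
  rel_interp :: "'r \<Rightarrow> 'a list \<Rightarrow> bool"

primrec eval_tm ::
  "('a::field, 'g::linordered_ab_group_add, 'f, 'r) vstruct \<Rightarrow> (nat \<Rightarrow> 'a) \<Rightarrow> 'f tm \<Rightarrow> 'a" where
  "eval_tm M e (Var i) = e i"
| "eval_tm M e Zero = 0"
| "eval_tm M e One = 1"
| "eval_tm M e (Plus s t) = eval_tm M e s + eval_tm M e t"
| "eval_tm M e (Minus s t) = eval_tm M e s - eval_tm M e t"
| "eval_tm M e (Times s t) = eval_tm M e s * eval_tm M e t"
| "eval_tm M e (Fn f ts) = fun_interp M f (map (eval_tm M e) ts)"

primrec sat ::
  "('a::field, 'g::linordered_ab_group_add, 'f, 'r) vstruct \<Rightarrow> (nat \<Rightarrow> 'a) \<Rightarrow> ('f, 'r) fm \<Rightarrow> bool" where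
  "sat M e (Eq s t) = (eval_tm M e s = eval_tm M e t)"
| "sat M e (ValLe s t) = (val M (eval_tm M e s) \<le> val M (eval_tm M e t))"
| "sat M e (Rel R ts) = rel_interp M R (map (eval_tm M e) ts)"
| "sat M e (Neg \<phi>) = (\<not> sat M e \<phi>)"
| "sat M e (Conj \<phi> \<psi>) = (sat M e \<phi> \<and> sat M e \<psi>)"
| "sat M e (Ex i \<phi>) = (\<exists>x. sat M (e(i := x)) \<phi>)"


section \<open>Definable sets, C-minimality\<close>

text \<open>
  \<open>X\<close>, a set of \<open>n\<close>-tuples, is definable with parameters: the variables \<open>0, \<dots>, n - 1\<close> stand for
  the tuple, all others are given parameters by \<open>e\<close> (only finitely many occur in \<open>\<phi>\<close>).
\<close>

definition definable ::
  "('f, 'r) lang \<Rightarrow> ('a::field, 'g::linordered_ab_group_add, 'f, 'r) vstruct \<Rightarrow> nat \<Rightarrow> 'a list set \<Rightarrow> bool" where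
  "definable L M n X \<longleftrightarrow>
     (\<exists>\<phi> e. wf_fm L \<phi> \<and>
        X = {xs. length xs = n \<and> sat M (\<lambda>i. if i < n then xs ! i else e i) \<phi>})"

definition definable_set ::
  "('f, 'r) lang \<Rightarrow> ('a::field, 'g::linordered_ab_group_add, 'f, 'r) vstruct \<Rightarrow> 'a set \<Rightarrow> bool" where
  "definable_set L M D \<longleftrightarrow> definable L M 1 {[x] | x. x \<in> D}"

definition definable_fun2 ::
  "('f, 'r) lang \<Rightarrow> ('a::field, 'g::linordered_ab_group_add, 'f, 'r) vstruct \<Rightarrow>
   ('a \<times> 'a) set \<Rightarrow> ('a \<times> 'a \<Rightarrow> 'a) \<Rightarrow> bool" where
  "definable_fun2 L M D f \<longleftrightarrow> definable L M 3 {[x, y, f (x, y)] | x y. (x, y) \<in> D}"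

inductive_set boolean_combinations :: "'a set set \<Rightarrow> 'a set set" for G :: "'a set set" where
  gen: "A \<in> G \<Longrightarrow> A \<in> boolean_combinations G"
| compl: "A \<in> boolean_combinations G \<Longrightarrow> - A \<in> boolean_combinations G"
| union: "A \<in> boolean_combinations G \<Longrightarrow> B \<in> boolean_combinations G \<Longrightarrow>
    A \<union> B \<in> boolean_combinations G"

definition C_minimal ::
  "('f, 'r) lang \<Rightarrow> ('a::field, 'g::linordered_ab_group_add, 'f, 'r) vstruct \<Rightarrow> bool" where
  "C_minimal L M \<longleftrightarrow>
     (\<forall>D. definable_set L M D \<longrightarrow>
        D \<in> boolean_combinations ({B. is_vball (val M) B} \<union> {{c} | c. True}))"


section \<open>Monster models\<close>

definition sentence :: "('f, 'r) lang \<Rightarrow> ('f, 'r) fm \<Rightarrow> bool" where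
  "sentence L \<phi> \<longleftrightarrow> wf_fm L \<phi> \<and> fv \<phi> = {}"

text \<open>
  A complete theory is identified with the set of its consequences. Together with \<open>models M T\<close>
  below this makes \<open>T\<close> the full theory of \<open>M\<close>.
\<close>

definition complete_theory :: "('f, 'r) lang \<Rightarrow> ('f, 'r) fm set \<Rightarrow> bool" where
  "complete_theory L T \<longleftrightarrow>
     (\<forall>\<phi>\<in>T. sentence L \<phi>) \<and> (\<forall>\<phi>. sentence L \<phi> \<longrightarrow> \<phi> \<in> T \<or> Neg \<phi> \<in> T)"

definition models ::
  "('a::field, 'g::linordered_ab_group_add, 'f, 'r) vstruct \<Rightarrow> ('f, 'r) fm set \<Rightarrow> bool" where
  "models M T \<longleftrightarrow> (\<forall>\<phi>\<in>T. \<forall>e. sat M e \<phi>)"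

text \<open>
  A formula with parameters from \<open>A\<close> in the single variable \<open>0\<close> is a pair \<open>(\<phi>, e)\<close> of a formula
  and an assignment sending all free variables of \<open>\<phi>\<close> other than \<open>0\<close> into \<open>A\<close>.
\<close>

definition formulas_over :: "('f, 'r) lang \<Rightarrow> 'a set \<Rightarrow> (('f, 'r) fm \<times> (nat \<Rightarrow> 'a)) set" where
  "formulas_over L A = {(\<phi>, e). wf_fm L \<phi> \<and> (\<forall>i\<in>fv \<phi> - {0}. e i \<in> A)}"

definition realises ::
  "('a::field, 'g::linordered_ab_group_add, 'f, 'r) vstruct \<Rightarrow> 'a \<Rightarrow>
   (('f, 'r) fm \<times> (nat \<Rightarrow> 'a)) set \<Rightarrow> bool" where
  "realises M x p \<longleftrightarrow> (\<forall>(\<phi>, e)\<in>p. sat M (e(0 := x)) \<phi>)"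

definition saturated ::
  "('f, 'r) lang \<Rightarrow> 'k rel \<Rightarrow> ('a::field, 'g::linordered_ab_group_add, 'f, 'r) vstruct \<Rightarrow> bool" where
  "saturated L \<kappa> M \<longleftrightarrow>
     (\<forall>A p. |A| <o \<kappa> \<and> p \<subseteq> formulas_over L A \<and>
        (\<forall>q. finite q \<and> q \<subseteq> p \<longrightarrow> (\<exists>x. realises M x q)) \<longrightarrow>
        (\<exists>x. realises M x p))"

definition partial_elementary ::
  "('f, 'r) lang \<Rightarrow> ('a::field, 'g::linordered_ab_group_add, 'f, 'r) vstruct \<Rightarrow> 'a set \<Rightarrow> ('a \<Rightarrow> 'a) \<Rightarrow> bool" where
  "partial_elementary L M A h \<longleftrightarrow>
     (\<forall>\<phi> e. wf_fm L \<phi> \<and> (\<forall>i\<in>fv \<phi>. e i \<in> A) \<longrightarrow> (sat M e \<phi> \<longleftrightarrow> sat M (h \<circ> e) \<phi>))"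

definition automorphism ::
  "('f, 'r) lang \<Rightarrow> ('a::field, 'g::linordered_ab_group_add, 'f, 'r) vstruct \<Rightarrow> ('a \<Rightarrow> 'a) \<Rightarrow> bool" where
  "automorphism L M \<sigma> \<longleftrightarrow>
     bij \<sigma> \<and> \<sigma> 0 = 0 \<and> \<sigma> 1 = 1 \<and>
     (\<forall>x y. \<sigma> (x + y) = \<sigma> x + \<sigma> y) \<and>
     (\<forall>x y. \<sigma> (x - y) = \<sigma> x - \<sigma> y) \<and>
     (\<forall>x y. \<sigma> (x * y) = \<sigma> x * \<sigma> y) \<and>
     (\<forall>x y. val M (\<sigma> x) \<le> val M (\<sigma> y) \<longleftrightarrow> val M x \<le> val M y) \<and>
     (\<forall>f xs. fun_arity L f = Some (length xs) \<longrightarrow>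
        fun_interp M f (map \<sigma> xs) = \<sigma> (fun_interp M f xs)) \<and>
     (\<forall>R xs. rel_arity L R = Some (length xs) \<longrightarrow>
        rel_interp M R (map \<sigma> xs) = rel_interp M R xs)"

definition strongly_homogeneous ::
  "('f, 'r) lang \<Rightarrow> 'k rel \<Rightarrow> ('a::field, 'g::linordered_ab_group_add, 'f, 'r) vstruct \<Rightarrow> bool" where
  "strongly_homogeneous L \<kappa> M \<longleftrightarrow>
     (\<forall>A h. |A| <o \<kappa> \<and> partial_elementary L M A h \<longrightarrow>
        (\<exists>\<sigma>. automorphism L M \<sigma> \<and> (\<forall>a\<in>A. \<sigma> a = h a)))"

text \<open>
  The cardinal \<open>\<kappa>\<close> bounds what is small. It only has to exceed the number of formulas, that is,
  \<open>|L| + \<aleph>\<^sub>0\<close>; stronger largeness conventions are special cases.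
\<close>

definition monster_model ::
  "('f, 'r) lang \<Rightarrow> 'k rel \<Rightarrow> ('f, 'r) fm set \<Rightarrow>
   ('a::field, 'g::linordered_ab_group_add, 'f, 'r) vstruct \<Rightarrow> bool" where
  "monster_model L \<kappa> T M \<longleftrightarrow>
     Card_order \<kappa> \<and> |{\<phi>. wf_fm L \<phi>}| <o \<kappa> \<and>
     models M T \<and> saturated L \<kappa> M \<and> strongly_homogeneous L \<kappa> M"

end

theory Submission
  imports Defs
begin

text \<open>
  Say that \<open>a\<close> is bad for the radius \<open>\<epsilon>\<close> if no neighbourhood of \<open>(a, 0)\<close> is mapped into the ball of
  radius \<open>\<epsilon>\<close> around \<open>f (a, 0)\<close>. By saturation, countably many radii have a common upper bound, so
  infinitely many discontinuities give infinitely many bad points for one radius \<open>\<epsilon>\<close>, hence by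
  C-minimality a ball of them. On that ball the radius \<open>\<delta>\<close> witnessing the limit of \<open>f (a, y)\<close> up to \<open>\<epsilon>\<close>
  may depend on \<open>a\<close>, but the same argument gives a smaller ball on which one \<open>\<delta>\<close> works. Finally some
  infinite subset of it is mapped by \<open>a \<mapsto> f (a, 0)\<close> into one ball of radius \<open>\<epsilon>\<close>: either the image is
  finite, or it contains such a ball. A ball in that subset consists of points that are not bad.
\<close>

section \<open>Definability with parameters\<close>

primrec rename_tm :: "(nat \<Rightarrow> nat) \<Rightarrow> 'f tm \<Rightarrow> 'f tm" where
  "rename_tm \<rho> (Var i) = Var (\<rho> i)"
| "rename_tm \<rho> Zero = Zero"
| "rename_tm \<rho> One = One"
| "rename_tm \<rho> (Plus s t) = Plus (rename_tm \<rho> s) (rename_tm \<rho> t)"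
| "rename_tm \<rho> (Minus s t) = Minus (rename_tm \<rho> s) (rename_tm \<rho> t)"
| "rename_tm \<rho> (Times s t) = Times (rename_tm \<rho> s) (rename_tm \<rho> t)"
| "rename_tm \<rho> (Fn f ts) = Fn f (map (rename_tm \<rho>) ts)"

primrec rename_fm :: "(nat \<Rightarrow> nat) \<Rightarrow> ('f, 'r) fm \<Rightarrow> ('f, 'r) fm" where
  "rename_fm \<rho> (Eq s t) = Eq (rename_tm \<rho> s) (rename_tm \<rho> t)"
| "rename_fm \<rho> (ValLe s t) = ValLe (rename_tm \<rho> s) (rename_tm \<rho> t)"
| "rename_fm \<rho> (Rel R ts) = Rel R (map (rename_tm \<rho>) ts)"
| "rename_fm \<rho> (Neg \<phi>) = Neg (rename_fm \<rho> \<phi>)"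
| "rename_fm \<rho> (Conj \<phi> \<psi>) = Conj (rename_fm \<rho> \<phi>) (rename_fm \<rho> \<psi>)"
| "rename_fm \<rho> (Ex i \<phi>) = Ex (\<rho> i) (rename_fm \<rho> \<phi>)"

lemma wf_rename_tm [simp]: "wf_tm L (rename_tm \<rho> t) = wf_tm L t"
  by (induction t) (simp_all add: list_all_iff)

lemma wf_rename_fm [simp]: "wf_fm L (rename_fm \<rho> \<phi>) = wf_fm L \<phi>"
  by (induction \<phi>) (simp_all add: list_all_iff)

lemma eval_rename_tm [simp]: "eval_tm M e (rename_tm \<rho> t) = eval_tm M (e \<circ> \<rho>) t"
  by (induction t) (simp_all cong: map_cong)

text \<open>Injectivity prevents capture: since a quantifier over \<open>i\<close> turns into one
  over \<open>\<rho> i\<close>, changing the assignment at \<open>\<rho> i\<close> must affect no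
  other variable of the original formula.\<close>

lemma sat_rename_fm:
  assumes "inj \<rho>"
  shows "sat M e (rename_fm \<rho> \<phi>) = sat M (e \<circ> \<rho>) \<phi>"
proof (induction \<phi> arbitrary: e)
  case (Rel R ts)
  show ?case
    by (simp add: comp_def)
next
  case (Ex i \<phi>)
  have "e(\<rho> i := x) \<circ> \<rho> = (e \<circ> \<rho>)(i := x)" for x
    using assms by (auto simp: fun_eq_iff inj_eq)
  then show ?case
    by (simp only: rename_fm.simps sat.simps Ex)
qed simp_all

definition interleave :: "(nat \<Rightarrow> 'a) \<Rightarrow> (nat \<Rightarrow> 'a) \<Rightarrow> (nat \<Rightarrow> 'a) \<Rightarrow> nat \<Rightarrow> 'a" where
  "interleave e c d i =
     (if i mod 3 = 0 then e (i div 3) else if i mod 3 = 1 then c (i div 3) else d (i div 3))"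

lemma interleave_simps [simp]:
  "interleave e c d (3 * i) = e i"
  "interleave e c d (Suc (3 * i)) = c i"
  "interleave e c d (Suc (Suc (3 * i))) = d i"
proof -
  have "Suc (3 * i) mod 3 = 1" "Suc (3 * i) div 3 = i" "Suc (Suc (3 * i)) mod 3 = 2"
    "Suc (Suc (3 * i)) div 3 = i"
    by presburger+
  then show "interleave e c d (3 * i) = e i" "interleave e c d (Suc (3 * i)) = c i"
    "interleave e c d (Suc (Suc (3 * i))) = d i"
    by (simp_all add: interleave_def)
qed

lemma nat_mod_3_cases:
  fixes i :: nat
  obtains j where "i = 3 * j" | j where "i = Suc (3 * j)" | j where "i = Suc (Suc (3 * j))"
  by (metis mod_0_imp_dvd add_Suc_right add.right_neutral mult_div_mod_eq mod_less_divisor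
      numeral_3_eq_3 less_Suc_eq not_less0 zero_less_Suc)

text \<open>
  The parameters \<open>c\<close> are fixed; the free variables, the parameters and a supply \<open>d\<close> of dummies,
  on which the truth value does not depend, occupy the three residue classes of indices, so that
  a quantifier always finds an unused variable.
\<close>

definition dfn ::
  "('f, 'r) lang \<Rightarrow> ('a::field, 'g::linordered_ab_group_add, 'f, 'r) vstruct \<Rightarrow> (nat \<Rightarrow> 'a) \<Rightarrow>
   ((nat \<Rightarrow> 'a) \<Rightarrow> bool) \<Rightarrow> bool" where
  "dfn L M c P \<longleftrightarrow> (\<exists>\<phi>. wf_fm L \<phi> \<and> (\<forall>e d. P e = sat M (interleave e c d) \<phi>))"

section \<open>Closure of definable predicates under connectives and quantifiers\<close>

lemma dfn_not: "dfn L M c P \<Longrightarrow> dfn L M c (\<lambda>e. \<not> P e)"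
  unfolding dfn_def by (metis sat.simps(4) wf_fm.simps(4))

lemma dfn_conj: "dfn L M c P \<Longrightarrow> dfn L M c Q \<Longrightarrow> dfn L M c (\<lambda>e. P e \<and> Q e)"
  unfolding dfn_def by (metis sat.simps(5) wf_fm.simps(5))

lemma dfn_imp: "dfn L M c P \<Longrightarrow> dfn L M c Q \<Longrightarrow> dfn L M c (\<lambda>e. P e \<longrightarrow> Q e)"
  using dfn_not[OF dfn_conj[OF _ dfn_not], of L M c P Q] by simp

text \<open>The hypothesis is in de Bruijn style, with the bound variable at 0 and the others
  shifted up. A renaming moves the bound variable to slot 2, the first dummy, where
  \<open>Ex\<close> can bind it.\<close>

lemma dfn_ex:
  assumes "dfn L M c (\<lambda>e. P (e 0) (\<lambda>i. e (Suc i)))"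
  shows "dfn L M c (\<lambda>e. \<exists>x. P x e)"
proof -
  obtain \<phi> where wf: "wf_fm L \<phi>"
    and \<phi>: "\<And>e d. P (e 0) (\<lambda>i. e (Suc i)) = sat M (interleave e c d) \<phi>"
    using assms unfolding dfn_def by blast
  \<comment> \<open>Slot 0 goes to 2, the remaining free variables move down by one place in their
    residue class, the parameters stay, and the dummies move up by one place to vacate slot
    2.\<close>
  define \<rho> where "\<rho> i = (if i = 0 then 2 else if i mod 3 = 0 then i - 3
    else if i mod 3 = 1 then i else i + 3)" for i :: nat
  have "inj \<rho>"
  proof (rule injI)
    fix i j :: nat
    assume "\<rho> i = \<rho> j"
    then show "i = j"
      unfolding \<rho>_def by (auto split: if_splits) presburger+
  qed
  \<comment> \<open>The renamed formula reads the dummies from \<open>d 1\<close> on. This does no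
    harm, as the truth value of \<open>\<phi>\<close> is the same for all dummies.\<close>
  moreover have "(interleave e c d)(2 := x) \<circ> \<rho> = interleave (case_nat x e) c (\<lambda>i. d (Suc i))" for e d x
  proof
    fix i :: nat
    show "((interleave e c d)(2 := x) \<circ> \<rho>) i = interleave (case_nat x e) c (\<lambda>i. d (Suc i)) i"
    proof (cases i rule: nat_mod_3_cases)
      case (1 j)
      show ?thesis
      proof (cases j)
        case 0
        then show ?thesis
          using 1 interleave_simps(1)[of "case_nat x e" c "\<lambda>i. d (Suc i)" 0] by (simp add: \<rho>_def)
      next
        case (Suc l)
        then have "\<rho> i = 3 * l"
          using 1 by (simp add: \<rho>_def)
        moreover from this have "\<rho> i \<noteq> 2"
          by presburger
        ultimately show ?thesis
          using 1 Suc interleave_simps(1)[of "case_nat x e" c "\<lambda>i. d (Suc i)" "Suc l"] by simp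
      qed
    next
      case (2 j)
      then have "\<rho> i = Suc (3 * j)"
        unfolding \<rho>_def by simp
      moreover from this have "\<rho> i \<noteq> 2"
        by presburger
      ultimately show ?thesis
        using 2 by simp
    next
      case (3 j)
      then have "\<rho> i = Suc (Suc (3 * Suc j))"
        unfolding \<rho>_def by simp presburger
      then show ?thesis
        using 3 interleave_simps(3)[of e c d "Suc j"] by simp
    qed
  qed
  ultimately have "(\<exists>x. P x e) = sat M (interleave e c d) (Ex 2 (rename_fm \<rho> \<phi>))" for e d
    using \<phi>[of "case_nat _ e"] by (simp add: sat_rename_fm)
  moreover have "wf_fm L (Ex 2 (rename_fm \<rho> \<phi>))"
    using wf by simp
  ultimately show ?thesis
    unfolding dfn_def by blast
qed

lemma dfn_all:
  assumes "dfn L M c (\<lambda>e. P (e 0) (\<lambda>i. e (Suc i)))"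
  shows "dfn L M c (\<lambda>e. \<forall>x. P x e)"
  using dfn_not[OF dfn_ex[OF dfn_not[OF assms]]] by simp

section \<open>Atomic predicates, graphs, and the passage to definable sets\<close>

lemma dfn_eq: "dfn L M c (\<lambda>e. e i = e j)"
  unfolding dfn_def by (rule exI[of _ "Eq (Var (3 * i)) (Var (3 * j))"]) simp

lemma dfn_val_less: "dfn L M c (\<lambda>e. val M (e i) < val M (e j - e k))"
  unfolding dfn_def
  by (rule exI[of _ "Neg (ValLe (Minus (Var (3 * j)) (Var (3 * k))) (Var (3 * i)))"]) (simp add: not_le)

text \<open>One parameter assignment \<open>c\<close> serves all choices of variables, so that
  formulas mentioning the graph several times can be combined. Distinct variables keep the renaming
  injective.\<close>

lemma dfn_graph:
  assumes "definable_fun2 L M S f"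
  obtains c where
    "\<And>i j k. distinct [i, j, k] \<Longrightarrow> dfn L M c (\<lambda>e. (e i, e j) \<in> S \<and> f (e i, e j) = e k)"
proof -
  obtain \<phi> c where wf: "wf_fm L \<phi>"
    and eq: "{[x, y, f (x, y)] | x y. (x, y) \<in> S} =
      {xs. length xs = 3 \<and> sat M (\<lambda>i. if i < 3 then xs ! i else c i) \<phi>}"
    using assms unfolding definable_fun2_def definable_def by blast
  have \<phi>: "((x, y) \<in> S \<and> f (x, y) = z) = sat M (\<lambda>i. if i < 3 then [x, y, z] ! i else c i) \<phi>" for x y z
    using eq[unfolded set_eq_iff, rule_format, of "[x, y, z]"] by auto
  have "dfn L M c (\<lambda>e. (e i, e j) \<in> S \<and> f (e i, e j) = e k)" if "distinct [i, j, k]" for i j k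
  proof -
    \<comment> \<open>The three coordinates go to the slots of the free variables \<open>i\<close>,
      \<open>j\<close>, \<open>k\<close>; a parameter with index \<open>n\<close> goes to the slot
      where \<open>interleave\<close> returns \<open>c n\<close>.\<close>
    define \<rho> where "\<rho> n = (if n < 3 then 3 * ([i, j, k] ! n) else Suc (3 * n))" for n
    have "3 * m \<noteq> Suc (3 * n)" for m n :: nat
      by presburger
    moreover have "[i, j, k] ! m = [i, j, k] ! n \<longleftrightarrow> m = n" if "m < 3" "n < 3" for m n
      using nth_eq_iff_index_eq[OF \<open>distinct [i, j, k]\<close>] that by simp
    ultimately have "inj \<rho>"
      unfolding inj_def \<rho>_def by (auto split: if_splits dest: sym)
    moreover have "interleave e c d \<circ> \<rho> = (\<lambda>n. if n < 3 then [e i, e j, e k] ! n else c n)" for e d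
      using nth_map[of _ "[i, j, k]" e] by (auto simp: fun_eq_iff \<rho>_def)
    ultimately have "sat M (interleave e c d) (rename_fm \<rho> \<phi>) \<longleftrightarrow>
        (e i, e j) \<in> S \<and> f (e i, e j) = e k" for e d
      by (simp add: sat_rename_fm \<phi>)
    then show ?thesis
      unfolding dfn_def using wf wf_rename_fm by metis
  qed
  then show ?thesis
    by (rule that)
qed

text \<open>All variables except 0 are fixed by \<open>p\<close>, so their values join
  \<open>c\<close> as parameters of the one-variable formula.\<close>

lemma dfn_imp_definable_set:
  assumes "dfn L M c P"
  shows "definable_set L M {x. P (case_nat x p)}"
proof -
  obtain \<phi> where wf: "wf_fm L \<phi>" and \<phi>: "\<And>e d. P e = sat M (interleave e c d) \<phi>"
    using assms unfolding dfn_def by blast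
  \<comment> \<open>Index 0 is overwritten by the entry of the tuple, so any value may stand there:
    \<open>y\<close> here, 0 below.\<close>
  have "(\<lambda>i. if i < 1 then [x] ! i else interleave (case_nat y p) c d i) = interleave (case_nat x p) c d"
    for x y d
    by (auto simp: fun_eq_iff interleave_def split: nat.split)
  then have "{[x] | x. x \<in> {x. P (case_nat x p)}} =
      {xs. length xs = 1 \<and> sat M (\<lambda>i. if i < 1 then xs ! i else interleave (case_nat 0 p) c c i) \<phi>}"
    by (auto simp: \<phi>[where d = c] length_Suc_conv)
  then show ?thesis
    unfolding definable_set_def definable_def using wf by blast
qed

section \<open>Valuations\<close>

text \<open>Ordered groups are torsion-free, and twice an infinite value is infinite. This gives
  \<open>v (- 1) = 0\<close> from the square of -1.\<close>

lemma extended_add_eq_0_iff: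
  fixes x :: "'g::linordered_ab_group_add extended"
  shows "x + x = 0 \<longleftrightarrow> x = 0"
  by (cases x) (auto simp: zero_extended_def)

context
  fixes v :: "'a::field \<Rightarrow> 'g::linordered_ab_group_add extended"
  assumes val: "valuation v"
begin

lemma v_eq_infinity_iff: "v x = \<infinity> \<longleftrightarrow> x = 0"
  and v_not_minus_infinity: "v x \<noteq> -\<infinity>"
  and v_mult: "v (x * y) = v x + v y"
  and v_add: "min (v x) (v y) \<le> v (x + y)"
  and v_surj: "\<exists>x. v x = Fin \<gamma>"
  using val unfolding valuation_def by blast+

lemma v_Fin:
  assumes "x \<noteq> 0"
  obtains \<gamma> where "v x = Fin \<gamma>"
  using assms v_eq_infinity_iff v_not_minus_infinity by (cases "v x") auto

text \<open>Every radius is the value of a nonzero field element. Radii are therefore written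
  \<open>v r\<close> with \<open>r \<noteq> 0\<close>, which lets formulas of the one-sorted
  language quantify over them.\<close>

lemma v_FinE:
  obtains x where "x \<noteq> 0" "v x = Fin \<gamma>"
  using v_surj v_eq_infinity_iff by (metis extended.distinct(1))

lemma v_less_0: "x \<noteq> 0 \<Longrightarrow> v x < v 0"
  using v_eq_infinity_iff by (metis v_Fin less_extended_simps(2))

lemma v_one: "v 1 = 0"
proof -
  obtain \<gamma> where "v 1 = Fin \<gamma>"
    using v_Fin[of 1] by auto
  then show ?thesis
    using v_mult[of 1 1] by (simp add: zero_extended_def)
qed

lemma v_minus: "v (- x) = v x"
proof -
  have "v (- 1) = 0"
    using v_mult[of "- 1" "- 1"] v_one by (simp add: extended_add_eq_0_iff)
  then show ?thesis
    using v_mult[of "- 1" x] by simp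
qed

lemma v_diff_commute: "v (x - y) = v (y - x)"
  using v_minus[of "x - y"] by simp

lemma less_v_diff_trans: "\<gamma> < v (x - y) \<Longrightarrow> \<gamma> < v (y - z) \<Longrightarrow> \<gamma> < v (x - z)"
  using v_add[of "x - y" "y - z"] less_le_trans[of \<gamma> "min (v (x - y)) (v (y - z))" "v (x - z)"] by simp

lemma v_less_mult:
  assumes "x \<noteq> 0" "0 < v u"
  shows "v x < v (x * u)"
proof -
  obtain \<gamma> where "v x = Fin \<gamma>"
    using v_Fin assms(1) by blast
  then show ?thesis
    using assms(2) by (cases "v u") (auto simp: v_mult zero_extended_def)
qed

lemma common_radius:
  assumes "r \<noteq> 0" "s \<noteq> 0"
  obtains q where "q \<noteq> 0" "v r \<le> v q" "v s \<le> v q"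
  using assms by (metis linear order_refl)

section \<open>The valuation topology in terms of radii\<close>

lemma openin_valuation_topology_ball:
  assumes "r \<noteq> 0"
  shows "openin (valuation_topology v) {x. v r < v (x - c)}"
proof -
  obtain \<gamma> where "v r = Fin \<gamma>"
    using v_Fin assms by blast
  then have "{x. v r < v (x - c)} = open_vball v c \<gamma>"
    by (simp add: open_vball_def)
  then show ?thesis
    unfolding valuation_topology_def by (auto intro!: topology_generated_by_Basis)
qed

lemma openin_valuation_topologyE:
  assumes "openin (valuation_topology v) U" "a \<in> U"
  obtains r where "r \<noteq> 0" "{x. v r < v (x - a)} \<subseteq> U"
proof -
  have "generate_topology_on {open_vball v c \<gamma> | c \<gamma>. True} U"
    using assms(1) openin_topology_generated_by unfolding valuation_topology_def by blast
  then have "a \<in> U \<longrightarrow> (\<exists>r. r \<noteq> 0 \<and> {x. v r < v (x - a)} \<subseteq> U)"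
  proof (induction rule: generate_topology_on.induct)
    case (Int V W)
    show ?case
    proof
      assume "a \<in> V \<inter> W"
      then obtain r s where rs: "r \<noteq> 0" "{x. v r < v (x - a)} \<subseteq> V" "s \<noteq> 0" "{x. v s < v (x - a)} \<subseteq> W"
        using Int.IH by auto
      obtain q where "q \<noteq> 0" "v r \<le> v q" "v s \<le> v q"
        using common_radius rs(1,3) by blast
      then show "\<exists>q. q \<noteq> 0 \<and> {x. v q < v (x - a)} \<subseteq> V \<inter> W"
        using rs by (intro exI[of _ q]) (auto dest: le_less_trans)
    qed
  next
    case (UN K)
    show ?case
    proof
      assume "a \<in> \<Union> K"
      then obtain V where V: "V \<in> K" "a \<in> V"
        by blast
      then obtain r where "r \<noteq> 0" "{x. v r < v (x - a)} \<subseteq> V"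
        using UN.IH by blast
      then show "\<exists>r. r \<noteq> 0 \<and> {x. v r < v (x - a)} \<subseteq> \<Union> K"
        using V(1) by (intro exI[of _ r]) auto
    qed
  next
    case (Basis S)
    then obtain c \<gamma> where S: "S = open_vball v c \<gamma>"
      by blast
    obtain r where r: "r \<noteq> 0" "v r = Fin \<gamma>"
      by (rule v_FinE)
    \<comment> \<open>Every point of an open ball is a centre of it, for the same radius.\<close>
    then have "{x. v r < v (x - a)} \<subseteq> S" if "a \<in> S"
      using that less_v_diff_trans unfolding S open_vball_def by auto
    then show ?case
      using r(1) by blast
  qed simp
  then show ?thesis
    using assms(2) that by blast
qed

lemma topspace_valuation_topology: "topspace (valuation_topology v) = UNIV"
proof -
  have "a \<in> topspace (valuation_topology v)" for a
    using openin_subset[OF openin_valuation_topology_ball[of 1 a]] v_less_0[of 1] by auto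
  then show ?thesis
    by blast
qed

text \<open>Points whose difference has value above the radius of \<open>C\<close> lie both inside
  or both outside \<open>C\<close>. Hence the open ball of that radius around any \<open>x\<close>
  lies on one side.\<close>

lemma vball_clopen:
  assumes "is_vball v C"
  shows "\<exists>r. r \<noteq> 0 \<and> ({y. v r < v (y - x)} \<subseteq> C \<or> {y. v r < v (y - x)} \<subseteq> - C)"
proof -
  obtain c \<gamma> where C: "C = open_vball v c \<gamma> \<or> C = closed_vball v c \<gamma>"
    using assms unfolding is_vball_def by blast
  obtain r where r: "r \<noteq> 0" "v r = Fin \<gamma>"
    by (rule v_FinE)
  have le: "Fin \<gamma> \<le> v (y - c)" if "Fin \<gamma> < v (y - x)" "Fin \<gamma> \<le> v (x - c)" for x y
    using that v_add[of "y - x" "x - c"] order_trans[of "Fin \<gamma>" "min (v (y - x)) (v (x - c))" "v (y - c)"]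
    by simp
  have "y \<in> C" if "x \<in> C" "v r < v (y - x)" for x y
    using C that r(2) le less_v_diff_trans[of "Fin \<gamma>" y x c]
    by (auto simp: open_vball_def closed_vball_def)
  then have "x \<in> C \<longleftrightarrow> y \<in> C" if "v r < v (y - x)" for x y
    using that v_diff_commute by metis
  then have "{y. v r < v (y - x)} \<subseteq> C \<or> {y. v r < v (y - x)} \<subseteq> - C"
    by auto
  then show ?thesis
    using r(1) by blast
qed

text \<open>Induction on the boolean combination: a ball has no exceptional points, a singleton has
  one, complements keep the exceptional set, and for unions the two sets are joined.\<close>

lemma finite_boundary:
  assumes "D \<in> boolean_combinations ({C. is_vball v C} \<union> {{c} | c. True})"
  shows "\<exists>F. finite F \<and> (\<forall>x. x \<notin> F \<longrightarrow>
    (\<exists>r. r \<noteq> 0 \<and> ({y. v r < v (y - x)} \<subseteq> D \<or> {y. v r < v (y - x)} \<subseteq> - D)))"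
  using assms
proof induction
  case (gen A)
  then show ?case
  proof
    assume "A \<in> {C. is_vball v C}"
    then show ?thesis
      using vball_clopen by blast
  next
    assume "A \<in> {{c} | c. True}"
    then obtain c where A: "A = {c}"
      by blast
    \<comment> \<open>The difference \<open>x - c\<close> is the radius: a point closer to
      \<open>x\<close> than \<open>c\<close> is cannot be \<open>c\<close>.\<close>
    have "{y. v (x - c) < v (y - x)} \<subseteq> - A" for x
      by (auto simp: A v_diff_commute)
    then have "\<forall>x. x \<notin> {c} \<longrightarrow> (\<exists>r. r \<noteq> 0 \<and> {y. v r < v (y - x)} \<subseteq> - A)"
      by (metis right_minus_eq singletonI)
    then show ?thesis
      by (meson finite.emptyI finite.insertI)
  qed
next
  case (compl A)
  then show ?case
    by (simp add: disj_commute)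
next
  case (union C D)
  then obtain F G where FG: "finite F" "finite G"
    and F: "\<And>x. x \<notin> F \<Longrightarrow> \<exists>r. r \<noteq> 0 \<and> ({y. v r < v (y - x)} \<subseteq> C \<or> {y. v r < v (y - x)} \<subseteq> - C)"
    and G: "\<And>x. x \<notin> G \<Longrightarrow> \<exists>r. r \<noteq> 0 \<and> ({y. v r < v (y - x)} \<subseteq> D \<or> {y. v r < v (y - x)} \<subseteq> - D)"
    by blast
  have "\<exists>q. q \<noteq> 0 \<and> ({y. v q < v (y - x)} \<subseteq> C \<union> D \<or> {y. v q < v (y - x)} \<subseteq> - (C \<union> D))"
    if x: "x \<notin> F \<union> G" for x
  proof -
    obtain r where r: "r \<noteq> 0" "{y. v r < v (y - x)} \<subseteq> C \<or> {y. v r < v (y - x)} \<subseteq> - C"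
      using F[of x] x by auto
    obtain s where s: "s \<noteq> 0" "{y. v s < v (y - x)} \<subseteq> D \<or> {y. v s < v (y - x)} \<subseteq> - D"
      using G[of x] x by auto
    obtain q where q: "q \<noteq> 0" "v r \<le> v q" "v s \<le> v q"
      using common_radius r(1) s(1) by blast
    then have "{y. v q < v (y - x)} \<subseteq> {y. v r < v (y - x)}" "{y. v q < v (y - x)} \<subseteq> {y. v s < v (y - x)}"
      by auto
    then show ?thesis
      using r(2) s(2) q(1) by (intro exI[of _ q]) blast
  qed
  then show ?case
    using FG by (intro exI[of _ "F \<union> G"]) simp
qed

end

section \<open>Consequences of nontriviality\<close>

lemma nontrivial_valuation_imp_valuation: "nontrivial_valuation v \<Longrightarrow> valuation v"
  by (simp add: nontrivial_valuation_def)

lemma nontrivial_valuation_posE: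
  assumes "nontrivial_valuation v"
  obtains u where "u \<noteq> 0" "0 < v u"
proof -
  note val = nontrivial_valuation_imp_valuation[OF assms]
  obtain x where x: "x \<noteq> 0" "v x \<noteq> 0"
    using assms unfolding nontrivial_valuation_def by blast
  obtain \<gamma> where g: "v x = Fin \<gamma>"
    using v_Fin[OF val x(1)] .
  obtain \<delta> where d: "v (inverse x) = Fin \<delta>"
    using v_Fin[OF val, of "inverse x"] x(1) by auto
  have "\<gamma> + \<delta> = 0"
    using v_mult[OF val, of x "inverse x"] v_one[OF val] x(1) g d by (simp add: zero_extended_def)
  then have "0 < v x \<or> 0 < v (inverse x)"
    using x(2) g d minus_unique[of \<gamma> \<delta>] by (auto simp: zero_extended_def)
  then show ?thesis
    using that x(1) by (metis nonzero_imp_inverse_nonzero)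
qed

text \<open>After translation to 0, a finite ball would have a nonzero element of largest value;
  multiplying it by an element of positive value stays in the ball and increases the value.\<close>

lemma infinite_ball:
  assumes "nontrivial_valuation v" "r \<noteq> 0"
  shows "infinite {x. v r < v (x - c)}"
proof
  note val = nontrivial_valuation_imp_valuation[OF assms(1)]
  obtain u where u: "u \<noteq> 0" "0 < v u"
    using nontrivial_valuation_posE[OF assms(1)] .
  define S where "S = {x. x \<noteq> 0 \<and> v r < v x}"
  assume "finite {x. v r < v (x - c)}"
  then have "finite ((\<lambda>x. x - c) ` {x. v r < v (x - c)})"
    by simp
  moreover have "S \<subseteq> (\<lambda>x. x - c) ` {x. v r < v (x - c)}"
    by (auto simp: S_def intro: image_eqI[of _ _ "_ + c"])
  ultimately have fin: "finite S"
    by (rule finite_subset[rotated])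
  have "r * u \<in> S"
    using v_less_mult[OF val] assms(2) u by (simp add: S_def)
  then have "Max (v ` S) \<in> v ` S"
    using fin by (intro Max_in) auto
  then obtain x where x: "x \<in> S" "Max (v ` S) = v x"
    by auto
  then have "v x < v (x * u)"
    using v_less_mult[OF val] u by (simp add: S_def)
  moreover from this have "x * u \<in> S"
    using x(1) u by (auto simp: S_def)
  then have "v (x * u) \<le> v x"
    using fin x(2) by (metis Max_ge finite_imageI imageI)
  ultimately show False
    by simp
qed

section \<open>Saturated C-minimal valued fields\<close>

text \<open>The condition \<open>natLeq <o \<kappa>\<close> makes countable parameter sets small, so
  that saturation applies to types over them.\<close>

locale saturated_C_minimal =
  fixes L :: "('f, 'r) lang"
    and M :: "('a::field, 'g::linordered_ab_group_add, 'f, 'r) vstruct"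
    and \<kappa> :: "'k rel"
  assumes nontriv: "nontrivial_valuation (val M)"
    and C_min: "C_minimal L M"
    and saturated: "saturated L \<kappa> M"
    and uncountable: "natLeq <o \<kappa>"
begin

abbreviation v where "v \<equiv> val M"

lemmas val = nontrivial_valuation_imp_valuation[OF nontriv]

text \<open>An infinite \<open>D\<close> has a point off the finite exceptional set. Some ball
  around it lies on one side of \<open>D\<close>, and the point itself decides the side.\<close>

lemma definable_infinite_imp_ball:
  assumes "definable_set L M D" "infinite D"
  obtains c r where "r \<noteq> 0" "{x. v r < v (x - c)} \<subseteq> D"
proof -
  obtain F where F: "finite F" "\<And>x. x \<notin> F \<Longrightarrow>
      \<exists>r. r \<noteq> 0 \<and> ({y. v r < v (y - x)} \<subseteq> D \<or> {y. v r < v (y - x)} \<subseteq> - D)"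
    using finite_boundary[OF val] C_min assms(1) unfolding C_minimal_def by metis
  obtain x where x: "x \<in> D" "x \<notin> F"
    using assms(2) F(1) by (meson finite_subset subsetI)
  then obtain r where r: "r \<noteq> 0" "{y. v r < v (y - x)} \<subseteq> D \<or> {y. v r < v (y - x)} \<subseteq> - D"
    using F(2) by blast
  moreover have "x \<in> {y. v r < v (y - x)}"
    using v_less_0[OF val r(1)] by simp
  ultimately show ?thesis
    using x(1) that by blast
qed

lemma finite_radius_bound:
  assumes "finite G"
  shows "\<exists>x. x \<noteq> 0 \<and> (\<forall>g\<in>G. g \<noteq> 0 \<longrightarrow> v g < v x)"
  using assms
proof induction
  case empty
  show ?case
    by (intro exI[of _ 1]) simp
next
  case (insert g G)
  then obtain x where x: "x \<noteq> 0" "\<And>h. h \<in> G \<Longrightarrow> h \<noteq> 0 \<Longrightarrow> v h < v x"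
    by blast
  obtain u where u: "u \<noteq> 0" "0 < v u"
    using nontrivial_valuation_posE[OF nontriv] .
  show ?case
  proof (cases "g = 0")
    case True
    then show ?thesis
      using x by blast
  next
    case False
    \<comment> \<open>The factor \<open>u\<close> of positive value makes the bound on
      \<open>v g\<close> strict.\<close>
    obtain q where "q \<noteq> 0" "v x \<le> v q" "v (g * u) \<le> v q"
      using common_radius[OF val x(1), of "g * u"] False u(1) by auto
    then show ?thesis
      using x(2) v_less_mult[OF val False u(2)]
      by (intro exI[of _ q]) (auto intro: less_le_trans)
  qed
qed

text \<open>The conditions \<open>v (g i) < v x\<close> together with \<open>x \<noteq> 0\<close>
  form a type over a countable set. Finitely many of them have a solution by the finite case, so
  saturation solves all at once.\<close>

lemma countable_radius_bound:
  assumes "\<And>i::nat. g i \<noteq> 0"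
  obtains x where "x \<noteq> 0" "\<And>i. v (g i) < v x"
proof -
  \<comment> \<open>Variable 1 carries the parameter \<open>g i\<close>. The clause against zero is
    essential, since 0 has value \<open>\<infinity>\<close> and would satisfy every
    inequality.\<close>
  define p :: "(('f, 'r) fm \<times> (nat \<Rightarrow> 'a)) set"
    where "p = range (\<lambda>i. (Conj (Neg (ValLe (Var 0) (Var 1))) (Neg (Eq (Var 0) Zero)), \<lambda>_. g i))"
  have "sat M (e(0 := x)) \<phi> \<longleftrightarrow> v (e 1) < v x \<and> x \<noteq> 0" if "(\<phi>, e) \<in> p" for \<phi> e x
    using that unfolding p_def by (auto simp: not_le)
  then have sat_iff: "realises M x q \<longleftrightarrow> (\<forall>(\<phi>, e)\<in>q. v (e 1) < v x \<and> x \<noteq> 0)" if "q \<subseteq> p" for x q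
    using that unfolding realises_def by (intro ball_cong) auto
  have "|range g| <o \<kappa>"
    using ordLeq_ordLess_trans[OF ordLeq_ordIso_trans[OF card_of_image card_of_nat] uncountable] .
  moreover have "p \<subseteq> formulas_over L (range g)"
    unfolding p_def formulas_over_def by auto
  moreover have "\<exists>x. realises M x q" if q: "finite q" "q \<subseteq> p" for q
  proof -
    obtain x where "x \<noteq> 0" "\<forall>h\<in>(\<lambda>(\<phi>, e). e 1) ` q. h \<noteq> 0 \<longrightarrow> v h < v x"
      using finite_radius_bound q(1) by (metis finite_imageI)
    then have "realises M x q"
      using q(2) assms unfolding sat_iff[OF q(2)] p_def by fastforce
    then show ?thesis ..
  qed
  ultimately obtain x where "realises M x p"
    using saturated[unfolded saturated_def, rule_format, of "range g" p] by metis
  then have "\<forall>(\<phi>, e)\<in>p. v (e 1) < v x \<and> x \<noteq> 0"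
    by (simp only: sat_iff[OF subset_refl])
  then have "x \<noteq> 0" "v (g i) < v x" for i
    unfolding p_def by auto
  then show ?thesis
    using that by blast
qed

text \<open>Pick countably many distinct points of the union, each with its index. A common upper
  bound for the values of these indices gives one \<open>S x\<close> containing all the
  points.\<close>

lemma infinite_directed_union:
  assumes "infinite (\<Union>r\<in>- {0}. S r)"
    and mono: "\<And>r s. v r < v s \<Longrightarrow> S r \<subseteq> S s"
  obtains r where "r \<noteq> 0" "infinite (S r)"
proof -
  obtain h :: "nat \<Rightarrow> _" where h: "inj h" "range h \<subseteq> (\<Union>r\<in>- {0}. S r)"
    using infinite_countable_subset[OF assms(1)] by blast
  then have "\<forall>i. \<exists>r. r \<noteq> 0 \<and> h i \<in> S r"
    by (auto simp: image_subset_iff)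
  then obtain g where g: "\<And>i. g i \<noteq> 0" "\<And>i. h i \<in> S (g i)"
    by metis
  obtain x where "x \<noteq> 0" "\<And>i. v (g i) < v x"
    using countable_radius_bound g(1) by blast
  moreover from this have "range h \<subseteq> S x"
    using g(2) mono by blast
  then have "infinite (S x)"
    using h(1) finite_subset range_inj_infinite by blast
  ultimately show ?thesis
    using that by blast
qed

section \<open>Finiteness of the set of bad points\<close>

lemmas dfn_intros = dfn_not dfn_conj dfn_imp dfn_ex dfn_all dfn_eq dfn_val_less

text \<open>Limits and continuity are stated with radii, the form in which formulas can express
  them.\<close>

lemma finite_bad_points:
  fixes f :: "'a \<times> 'a \<Rightarrow> 'a"
  assumes graph: "\<And>i j k. distinct [i, j, k] \<Longrightarrow>
      dfn L M c (\<lambda>e. (e i, e j) \<in> U \<times> B \<and> f (e i, e j) = e k)"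
    and B: "0 \<in> B"
    and U: "openin (valuation_topology v) U"
    and lim: "\<And>a d. a \<in> U \<Longrightarrow> d \<noteq> 0 \<Longrightarrow>
      \<exists>s. s \<noteq> 0 \<and> (\<forall>y\<in>B. v s < v y \<longrightarrow> v d < v (f (a, y) - f (a, 0)))"
  shows "finite {a \<in> U. \<exists>d. d \<noteq> 0 \<and> \<not> (\<exists>r s. r \<noteq> 0 \<and> s \<noteq> 0 \<and>
    (\<forall>a'\<in>U. \<forall>y\<in>B. v r < v (a' - a) \<longrightarrow> v s < v y \<longrightarrow> v d < v (f (a', y) - f (a, 0))))}"
proof (rule ccontr)
  define good where "good d a \<longleftrightarrow> (\<exists>r s. r \<noteq> 0 \<and> s \<noteq> 0 \<and>
    (\<forall>a'\<in>U. \<forall>y\<in>B. v r < v (a' - a) \<longrightarrow> v s < v y \<longrightarrow> v d < v (f (a', y) - f (a, 0))))" for d a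
  have eqD: "definable_set L M D" if "dfn L M c P" "D = {x. P (case_nat x p)}" for D P p
    using dfn_imp_definable_set that by blast
  \<comment> \<open>Formulas reach the values of \<open>f\<close> through its graph over
    \<open>U \<times> B\<close>.\<close>
  define G where "G x y z \<longleftrightarrow> (x, y) \<in> U \<times> B \<and> f (x, y) = z" for x y z
  have dfn_G: "dfn L M c (\<lambda>e. G (e i) (e j) (e k))" if "distinct [i, j, k]" for i j k
    using graph[OF that] unfolding G_def .
  assume "\<not> finite {a \<in> U. \<exists>d. d \<noteq> 0 \<and> \<not> (\<exists>r s. r \<noteq> 0 \<and> s \<noteq> 0 \<and>
    (\<forall>a'\<in>U. \<forall>y\<in>B. v r < v (a' - a) \<longrightarrow> v s < v y \<longrightarrow> v d < v (f (a', y) - f (a, 0))))}"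
  moreover have "{a \<in> U. \<exists>d. d \<noteq> 0 \<and> \<not> good d a} = (\<Union>d\<in>- {0}. {a \<in> U. \<not> good d a})"
    by blast
  ultimately have "infinite (\<Union>d\<in>- {0}. {a \<in> U. \<not> good d a})"
    unfolding good_def by simp
  moreover have "{a \<in> U. \<not> good d a} \<subseteq> {a \<in> U. \<not> good d' a}" if "v d < v d'" for d d'
    using that unfolding good_def by (blast intro: less_trans)
  ultimately obtain d where d: "d \<noteq> 0" "infinite {a \<in> U. \<not> good d a}"
    by (rule infinite_directed_union)
  \<comment> \<open>Here \<open>e 0\<close> is the point \<open>a\<close>, \<open>e 1\<close> is the
    field element 0, and \<open>e 2\<close> is \<open>d\<close>. As \<open>0 \<in> B\<close>, the
    existence of \<open>w\<close> expresses \<open>a \<in> U\<close>.\<close>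
  have "dfn L M c (\<lambda>e. (\<exists>w. G (e 0) (e 1) w) \<and> \<not> (\<exists>r s. r \<noteq> e 1 \<and> s \<noteq> e 1 \<and>
      (\<forall>a' y z w. G a' y z \<and> G (e 0) (e 1) w \<longrightarrow> v r < v (a' - e 0) \<longrightarrow> v s < v (y - e 1) \<longrightarrow>
        v (e 2) < v (z - w))))"
    by (intro dfn_intros dfn_G) simp_all
  then have "definable_set L M {a \<in> U. \<not> good d a}"
    by (rule eqD[where p = "case_nat 0 (\<lambda>_. d)"])
      (use B in \<open>auto simp: G_def good_def numeral_2_eq_2\<close>)
  \<comment> \<open>All points of this ball are bad for \<open>d\<close>; the contradiction will be
    a point of it that is good for \<open>d\<close>.\<close>
  then obtain a0 r0 where r0: "r0 \<noteq> 0" and ball0: "{x. v r0 < v (x - a0)} \<subseteq> {a \<in> U. \<not> good d a}"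
    using d(2) by (rule definable_infinite_imp_ball)
  \<comment> \<open>\<open>W s\<close> collects the points of the ball for which \<open>s\<close>
    witnesses the limit up to \<open>d\<close>. These sets grow with \<open>v s\<close> and cover
    the ball by the limit hypothesis.\<close>
  define W where
    "W s = {a. v r0 < v (a - a0) \<and> (\<forall>y\<in>B. v s < v y \<longrightarrow> v d < v (f (a, y) - f (a, 0)))}" for s
  have "{a. v r0 < v (a - a0)} \<subseteq> (\<Union>s\<in>- {0}. W s)"
    using lim d(1) ball0 unfolding W_def by fastforce
  then have "infinite (\<Union>s\<in>- {0}. W s)"
    using infinite_ball[OF nontriv r0] finite_subset by blast
  moreover have "W s \<subseteq> W s'" if "v s < v s'" for s s'
    using that unfolding W_def by (auto intro: less_trans)
  ultimately obtain s where s: "s \<noteq> 0" "infinite (W s)"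
    by (rule infinite_directed_union)
  \<comment> \<open>The variables 1 to 5 stand for 0, \<open>d\<close>, \<open>s\<close>,
    \<open>a0\<close>, \<open>r0\<close>.\<close>
  have "dfn L M c (\<lambda>e. v (e 5) < v (e 0 - e 4) \<and> (\<forall>y z w. G (e 0) y z \<longrightarrow> G (e 0) (e 1) w \<longrightarrow>
      v (e 3) < v (y - e 1) \<longrightarrow> v (e 2) < v (z - w)))"
    by (intro dfn_intros dfn_G) simp_all
  then have "definable_set L M (W s)"
    by (rule eqD[where p = "case_nat 0 (case_nat d (case_nat s (case_nat a0 (\<lambda>_. r0))))"])
      (use B ball0 in \<open>auto simp: W_def G_def numeral_eq_Suc\<close>)
  then obtain a1 r1 where r1: "r1 \<noteq> 0" and ball1: "{x. v r1 < v (x - a1)} \<subseteq> W s"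
    using s(2) by (rule definable_infinite_imp_ball)
  have sub: "{x. v r1 < v (x - a1)} \<subseteq> U"
    using ball0 ball1 unfolding W_def by blast
  let ?im = "(\<lambda>a. f (a, 0)) ` {a. v r1 < v (a - a1)}"
  \<comment> \<open>A finite image has an infinite fibre over one of its values; an infinite image
    is definable and contains a ball, whose centre is taken as \<open>w\<close>.\<close>
  have "\<exists>w. infinite {a. v r1 < v (a - a1) \<and> v d < v (f (a, 0) - w)}"
  proof (cases "finite ?im")
    case True
    then obtain w where "infinite {a \<in> {a. v r1 < v (a - a1)}. f (a, 0) = f (w, 0)}"
      using pigeonhole_infinite[OF infinite_ball[OF nontriv r1]] by blast
    then have "infinite {a. v r1 < v (a - a1) \<and> f (a, 0) = f (w, 0)}"
      by simp
    moreover have "{a. v r1 < v (a - a1) \<and> f (a, 0) = f (w, 0)}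
        \<subseteq> {a. v r1 < v (a - a1) \<and> v d < v (f (a, 0) - f (w, 0))}"
      using v_less_0[OF val d(1)] by auto
    ultimately show ?thesis
      using finite_subset by blast
  next
    case False
    have "dfn L M c (\<lambda>e. \<exists>a. v (e 3) < v (a - e 2) \<and> G a (e 1) (e 0))"
      by (intro dfn_intros dfn_G) simp_all
    then have "definable_set L M ?im"
      by (rule eqD[where p = "case_nat 0 (case_nat a1 (\<lambda>_. r1))"])
        (use B sub in \<open>auto simp: G_def numeral_eq_Suc\<close>)
    then obtain w q where q: "q \<noteq> 0" "{x. v q < v (x - w)} \<subseteq> ?im"
      using False by (rule definable_infinite_imp_ball)
    \<comment> \<open>The ball of radius \<open>q'\<close> around \<open>w\<close> lies both in the
      image and in the ball of radius \<open>d\<close>. It is infinite and covered by the image of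
      \<open>?A\<close>, hence so is \<open>?A\<close> infinite.\<close>
    obtain q' where q': "q' \<noteq> 0" "v q \<le> v q'" "v d \<le> v q'"
      using common_radius[OF val q(1) d(1)] .
    let ?A = "{a. v r1 < v (a - a1) \<and> v d < v (f (a, 0) - w)}"
    have "{x. v q' < v (x - w)} \<subseteq> (\<lambda>a. f (a, 0)) ` ?A"
    proof
      fix x
      assume x: "x \<in> {x. v q' < v (x - w)}"
      then have "x \<in> ?im"
        using q(2) q'(2) by (auto dest: le_less_trans)
      then show "x \<in> (\<lambda>a. f (a, 0)) ` ?A"
        using x q'(3) by (auto dest: le_less_trans)
    qed
    then have "infinite ?A"
      using infinite_ball[OF nontriv q'(1)] by (meson finite_imageI finite_subset)
    then show ?thesis
      by blast
  qed
  then obtain w where w: "infinite {a. v r1 < v (a - a1) \<and> v d < v (f (a, 0) - w)}" ..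
  have "dfn L M c (\<lambda>e. v (e 3) < v (e 0 - e 2) \<and> (\<exists>z. G (e 0) (e 1) z \<and> v (e 5) < v (z - e 4)))"
    by (intro dfn_intros dfn_G) simp_all
  then have "definable_set L M {a. v r1 < v (a - a1) \<and> v d < v (f (a, 0) - w)}"
    by (rule eqD[where p = "case_nat 0 (case_nat a1 (case_nat r1 (case_nat w (\<lambda>_. d))))"])
      (use B sub in \<open>auto simp: G_def numeral_eq_Suc\<close>)
  then obtain a2 r2 where r2: "r2 \<noteq> 0"
    and ball2: "{x. v r2 < v (x - a2)} \<subseteq> {a. v r1 < v (a - a1) \<and> v d < v (f (a, 0) - w)}"
    using w by (rule definable_infinite_imp_ball)
  have a2: "v r1 < v (a2 - a1)" "v d < v (f (a2, 0) - w)"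
    using subsetD[OF ball2, of a2] v_less_0[OF val r2] by simp_all
  \<comment> \<open>The ultrametric inequality is applied along \<open>f (a, y)\<close>,
    \<open>f (a, 0)\<close>, \<open>w\<close>, \<open>f (a2, 0)\<close>: the first step is uniform
    in \<open>a\<close> by \<open>W s\<close>, the others come from the choice of
    \<open>w\<close>.\<close>
  have "v d < v (f (a, y) - f (a2, 0))" if "y \<in> B" "v r2 < v (a - a2)" "v s < v y" for a y
  proof (rule less_v_diff_trans[OF val])
    have a: "v r1 < v (a - a1)" "v d < v (f (a, 0) - w)"
      using ball2 that(2) by auto
    show "v d < v (f (a, y) - f (a, 0))"
      using a(1) ball1 that unfolding W_def by blast
    show "v d < v (f (a, 0) - f (a2, 0))"
      using a(2) a2(2) less_v_diff_trans[OF val] v_diff_commute[OF val] by metis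
  qed
  then have "good d a2"
    using r2 s(1) unfolding good_def by blast
  then show False
    using a2(1) ball0 ball1 unfolding W_def by blast
qed

end

section \<open>From radii back to the topologies\<close>

lemma monster_model_uncountable:
  assumes "monster_model L \<kappa> T M"
  shows "natLeq <o \<kappa>"
proof -
  \<comment> \<open>These formulas are already infinitely many, and \<open>\<kappa>\<close> exceeds
    the number of all formulas.\<close>
  have "range (\<lambda>i. Eq (Var i) (Var i)) \<subseteq> {\<phi>. wf_fm L \<phi>}"
    by auto
  moreover have "inj (\<lambda>i. Eq (Var i) (Var i))"
    by (auto simp: inj_def)
  ultimately have "infinite {\<phi>. wf_fm L \<phi>}"
    using finite_subset range_inj_infinite by blast
  then show ?thesis
    using assms infinite_iff_natLeq_ordLeq ordLeq_ordLess_trans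
    unfolding monster_model_def by blast
qed

theorem theorem8p1:
  fixes L :: "('f, 'r) lang"
    and T :: "('f, 'r) fm set"
    and \<kappa> :: "'k rel"
    and M :: "('a::alg_closed_field, 'g::linordered_ab_group_add, 'f, 'r) vstruct"
    and t :: 'f
    and U B :: "'a set"
    and f :: "'a \<times> 'a \<Rightarrow> 'a"
  assumes "complete_theory L T"
    and "monster_model L \<kappa> T M"
    and "nontrivial_valuation (val M)"
    and "C_minimal L M"
    and "fun_arity L t = Some 0"
    and "val M (fun_interp M t []) > 0"
    and "is_vball (val M) B"
    and "0 \<in> B"
    and "definable_set L M U"
    and "openin (valuation_topology (val M)) U"
    and "definable_fun2 L M (U \<times> B) f"
    and "\<And>a. a \<in> U \<Longrightarrow>
           limitin (valuation_topology (val M)) (\<lambda>y. f (a, y)) (f (a, 0))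
             (atin_within (valuation_topology (val M)) 0 B)"
  shows "finite {a \<in> U.
           \<not> topcontinuous_at
               (subtopology
                  (prod_topology (valuation_topology (val M)) (valuation_topology (val M))) (U \<times> B))
               (valuation_topology (val M)) f (a, 0)}"
proof -
  interpret saturated_C_minimal L M \<kappa>
    using assms(2-4) monster_model_uncountable by unfold_locales (auto simp: monster_model_def)
  let ?T = "valuation_topology v"
  obtain c where graph: "\<And>i j k. distinct [i, j, k] \<Longrightarrow>
      dfn L M c (\<lambda>e. (e i, e j) \<in> U \<times> B \<and> f (e i, e j) = e k)"
    using dfn_graph[OF assms(11)] by blast
  have lim: "\<exists>s. s \<noteq> 0 \<and> (\<forall>y\<in>B. v s < v y \<longrightarrow> v d < v (f (a, y) - f (a, 0)))"
    if a: "a \<in> U" and d: "d \<noteq> 0" for a d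
  proof -
    have "openin ?T {x. v d < v (x - f (a, 0))}" "f (a, 0) \<in> {x. v d < v (x - f (a, 0))}"
      using openin_valuation_topology_ball[OF val d] v_less_0[OF val d] by auto
    then have "\<forall>\<^sub>F y in atin_within ?T 0 B. f (a, y) \<in> {x. v d < v (x - f (a, 0))}"
      using assms(12)[OF a] unfolding limitin_def by blast
    then obtain V where V: "openin ?T V" "0 \<in> V"
      "\<And>y. y \<in> V \<Longrightarrow> y \<in> B \<Longrightarrow> y \<noteq> 0 \<Longrightarrow> v d < v (f (a, y) - f (a, 0))"
      unfolding eventually_atin_within topspace_valuation_topology[OF val] by auto
    obtain s where "s \<noteq> 0" "{x. v s < v (x - 0)} \<subseteq> V"
      using openin_valuation_topologyE[OF val V(1,2)] .
    \<comment> \<open>The filter \<open>atin_within\<close> leaves out \<open>y = 0\<close>, where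
      the claim is \<open>v d < v 0\<close>.\<close>
    then have "s \<noteq> 0 \<and> (\<forall>y\<in>B. v s < v y \<longrightarrow> v d < v (f (a, y) - f (a, 0)))"
      using V(3) v_less_0[OF val d] by (metis (mono_tags, lifting) diff_self diff_zero mem_Collect_eq subsetD)
    then show ?thesis ..
  qed
  \<comment> \<open>Contraposition of this puts every point of discontinuity into the finite set of
    bad points.\<close>
  have "topcontinuous_at (subtopology (prod_topology ?T ?T) (U \<times> B)) ?T f (a, 0)"
    if a: "a \<in> U" and good: "\<And>d. d \<noteq> 0 \<Longrightarrow> \<exists>r s. r \<noteq> 0 \<and> s \<noteq> 0 \<and>
      (\<forall>a'\<in>U. \<forall>y\<in>B. v r < v (a' - a) \<longrightarrow> v s < v y \<longrightarrow> v d < v (f (a', y) - f (a, 0)))" for a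
    unfolding topcontinuous_at_def
  proof (intro conjI allI impI)
    show "(a, 0) \<in> topspace (subtopology (prod_topology ?T ?T) (U \<times> B))"
      using a assms(8) by (simp add: topspace_valuation_topology[OF val])
    show "f \<in> topspace (subtopology (prod_topology ?T ?T) (U \<times> B)) \<rightarrow> topspace ?T"
      by (simp add: topspace_valuation_topology[OF val])
    fix V
    assume "openin ?T V \<and> f (a, 0) \<in> V"
    then obtain d where d: "d \<noteq> 0" "{x. v d < v (x - f (a, 0))} \<subseteq> V"
      using openin_valuation_topologyE[OF val] by blast
    obtain r s where r: "r \<noteq> 0" and s: "s \<noteq> 0"
      and rs: "\<And>a' y. a' \<in> U \<Longrightarrow> y \<in> B \<Longrightarrow> v r < v (a' - a) \<Longrightarrow> v s < v y \<Longrightarrow>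
        v d < v (f (a', y) - f (a, 0))"
      using good[OF d(1)] by blast
    let ?N = "({x. v r < v (x - a)} \<times> {y. v s < v (y - 0)}) \<inter> (U \<times> B)"
    have "openin (prod_topology ?T ?T) ({x. v r < v (x - a)} \<times> {y. v s < v (y - 0)})"
      using openin_valuation_topology_ball[OF val] r s by (simp only: openin_prod_Times_iff) blast
    then have "openin (subtopology (prod_topology ?T ?T) (U \<times> B)) ?N"
      by (auto simp: openin_subtopology)
    moreover have "(a, 0) \<in> ?N"
      using a assms(8) v_less_0[OF val] r s by simp
    moreover have "\<forall>p\<in>?N. f p \<in> V"
      using rs d(2) by auto
    ultimately show "\<exists>N. openin (subtopology (prod_topology ?T ?T) (U \<times> B)) N \<and> (a, 0) \<in> N \<and>
        (\<forall>p\<in>N. f p \<in> V)"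
      by blast
  qed
  then show ?thesis
    by (intro finite_subset[OF _ finite_bad_points[OF graph assms(8,10) lim]]) blast+
qed

end
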